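(* Let $K\subset\mathbb{R}^d$ be compact, let $f:K\to\mathbb{R}^d$ be Lipschitz continuous, let $\phi_1,\dots,\phi_M\in \mathbf{C}^1(K)$ be kernel functions, and let $A=[a^k_\ell]_{k,\ell=1}^M\in\mathbb{R}^{M\times M}$ (row index $k$, column index $\ell$). Let $x_1,\dots,x_N$ be agents with $\dot x_i(t)=f(x_i(t))$, $i=1,\dots,N$, and assume that $x_i(t)\in K$ for all $i$ and all $t\in[0,T]$. Let $m(t)=(m_1(t),\dots,m_M(t))$ be the true moments, $m_k(t)=\frac1N\sum_{i=1}^N\phi_k(x_i(t))$, and let $\overline m(t)\in\mathbb{R}^M$ be a solution of the approximate moment dynamics $\dot{\overline m}(t)=A\,\overline m(t)$. Define $$\varepsilon_k(x)=\frac{\partial\phi_k(x)}{\partial x}f(x)-\sum_{\ell=1}^M a^k_\ell\,\phi_\ell(x),\qquad x\in K.$$ Then for $t\in[0,T]$ the difference $\Delta m(t)=m(t)-\overline m(t)$ satisfies $$\|\Delta m(t)\|\le \|\Delta m(0)\|e^{t\nu[A]}+\frac{e^{t\nu[A]}-1}{\nu[A]}\sqrt{\sum_{k=1}^M\max_{x\in K}\varepsilon_k(x)^2}\quad\text{if }\nu[A]\ne0,$$ and $$\|\Delta m(t)\|\le \|\Delta m(0)\|+t\sqrt{\sum_{k=1}^M\max_{x\in K}\varepsilon_k(x)^2}\quad\text{if }\nu[A]=0.$$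
   Context: $\|\cdot\|$ denotes the Euclidean vector norm and the induced matrix norm. $\mathbf{C}^1(K)$ is the set of continuously differentiable real-valued functions on $K$; $\partial\phi_k/\partial x$ is the gradient as a row vector. The logarithmic $2$-norm of a square real matrix $A$ is $\nu[A]=\lim_{h\to0^+}\frac{\|I+hA\|-1}{h}$, which equals $\lambda_{\max}(A+A^* )/2$. The true moments satisfy $\dot m_k(t)=\int_K\frac{\partial\phi_k(x)}{\partial x}f(x)\,d\mu_t(x)$, where $\mu_t=\frac1N\sum_{i=1}^N\delta_{x_i(t)}$ is the occupation measure of the agents. *)

theory Defs
  imports "HOL-Analysis.Analysis"
begin

(* For a general compact set K the derivative of g relative to K need not be unique, so the
   gradient Dg is carried along as data: any continuous field on K that is a derivative of g
   relative to K is admitted.  If g is the restriction of a C^1 function on a neighbourhood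
   of K, the ordinary gradient of that function is one such Dg. *)
definition C1_on :: "(real^'d) set \<Rightarrow> (real^'d \<Rightarrow> real) \<Rightarrow> (real^'d \<Rightarrow> real^'d) \<Rightarrow> bool" where
  "C1_on K g Dg \<longleftrightarrow>
     (\<forall>x\<in>K. (g has_derivative (\<lambda>v. Dg x \<bullet> v)) (at x within K)) \<and> continuous_on K Dg"

definition log_norm :: "real^'m^'m \<Rightarrow> real" where
  "log_norm A = Lim (at_right 0) (\<lambda>h. (onorm ((*v) (mat 1 + h *\<^sub>R A)) - 1) / h)"

definition moments ::
    "('m::finite \<Rightarrow> real^'d \<Rightarrow> real) \<Rightarrow> nat \<Rightarrow> (nat \<Rightarrow> real \<Rightarrow> real^'d) \<Rightarrow> real \<Rightarrow> real^'m" where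
  "moments \<phi> N x t = (\<chi> k. (1 / real N) * (\<Sum>i=1..N. \<phi> k (x i t)))"

definition closure_error ::
    "('m::finite \<Rightarrow> real^'d \<Rightarrow> real) \<Rightarrow> ('m \<Rightarrow> real^'d \<Rightarrow> real^'d) \<Rightarrow> (real^'d \<Rightarrow> real^'d)
      \<Rightarrow> real^'m^'m \<Rightarrow> 'm \<Rightarrow> real^'d \<Rightarrow> real" where
  "closure_error \<phi> D\<phi> f A k x = D\<phi> k x \<bullet> f x - (\<Sum>l\<in>UNIV. A $ k $ l * \<phi> l x)"

(* The library's Max is meaningful for finite sets only. *)
definition max_on :: "'a set \<Rightarrow> ('a \<Rightarrow> real) \<Rightarrow> real" where
  "max_on K g = (GREATEST y. y \<in> g ` K)"

end

theory Submission
  imports Defs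
begin

(* The quotient defining the logarithmic norm nu is monotone in h because the norm is convex, so
   the limit exists and is the infimum; Cauchy-Schwarz then gives <A v, v> <= nu |v|^2.  The
   difference v of the true and approximate moments solves v' = A v + e with |e| <= E, where
   e averages the closure error over the agents.  As the norm is not differentiable at 0,
   Gronwall's argument is run for u = sqrt (|v|^2 + d^2), which satisfies
   u' <= nu u + E + |nu| d, and d tends to 0 at the end. *)

section \<open>The logarithmic norm: convergence of its quotient and the bound on the quadratic
  form\<close>

lemma matrix_plus_scaleR_vector_mult:
  fixes A :: "real^'n^'n"
  shows "(mat 1 + h *\<^sub>R A) *v v = v + h *\<^sub>R (A *v v)"
  by (simp add: matrix_vector_mult_add_rdistrib scaleR_matrix_vector_assoc)

text \<open>Cauchy-Schwarz for \<open>v\<close> and its image under I + hA bounds |v|^2 + h <v, Av>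
  by the operator norm times |v|^2; subtracting |v|^2 and dividing by h > 0 leaves the
  quotient.\<close>

lemma inner_le_log_norm_quotient:
  fixes A :: "real^'m^'m"
  assumes "h > 0"
  shows "v \<bullet> (A *v v) \<le> (onorm ((*v) (mat 1 + h *\<^sub>R A)) - 1) / h * (norm v)\<^sup>2"
proof -
  let ?B = "mat 1 + h *\<^sub>R A"
  have "(norm v)\<^sup>2 + h * (v \<bullet> (A *v v)) = v \<bullet> (?B *v v)"
    by (simp add: matrix_plus_scaleR_vector_mult inner_add_right power2_norm_eq_inner)
  also have "\<dots> \<le> norm v * norm (?B *v v)"
    by (rule norm_cauchy_schwarz)
  also have "\<dots> \<le> norm v * (onorm ((*v) ?B) * norm v)"
    by (intro mult_left_mono onorm matrix_vector_mul_bounded_linear) simp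
  finally show ?thesis
    using assms by (simp add: field_simps power2_eq_square)
qed

text \<open>I + sA is the convex combination of I and I + tA with weights 1 - s/t and s/t, and I has
  norm at most 1; convexity of the norm then rearranges to the claim.\<close>

lemma log_norm_quotient_mono:
  fixes A :: "real^'m^'m"
  assumes "0 < s" "s \<le> t"
  shows "(onorm ((*v) (mat 1 + s *\<^sub>R A)) - 1) / s \<le> (onorm ((*v) (mat 1 + t *\<^sub>R A)) - 1) / t"
proof -
  let ?r = "s / t" and ?n = "\<lambda>h. onorm ((*v) (mat 1 + h *\<^sub>R A))"
  have r: "0 \<le> ?r" "?r \<le> 1" and t: "t > 0"
    using assms by auto
  have "norm ((mat 1 + s *\<^sub>R A) *v v) \<le> ((1 - ?r) + ?r * ?n t) * norm v" for v
  proof -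
    have "(mat 1 + s *\<^sub>R A) *v v = (1 - ?r) *\<^sub>R v + ?r *\<^sub>R ((mat 1 + t *\<^sub>R A) *v v)"
      unfolding matrix_plus_scaleR_vector_mult
      using t by (simp add: scaleR_add_right scaleR_left_diff_distrib del: scaleR_matrix_vector_assoc)
    then have "norm ((mat 1 + s *\<^sub>R A) *v v)
        \<le> norm ((1 - ?r) *\<^sub>R v) + norm (?r *\<^sub>R ((mat 1 + t *\<^sub>R A) *v v))"
      by (metis norm_triangle_ineq)
    also have "\<dots> = (1 - ?r) * norm v + ?r * norm ((mat 1 + t *\<^sub>R A) *v v)"
      using r unfolding norm_scaleR by (simp only: abs_of_nonneg diff_ge_0_iff_ge)
    also have "\<dots> \<le> (1 - ?r) * norm v + ?r * (?n t * norm v)"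
      by (intro add_left_mono mult_left_mono onorm matrix_vector_mul_bounded_linear r)
    finally show ?thesis
      by (simp add: algebra_simps)
  qed
  then have "?n s \<le> (1 - ?r) + ?r * ?n t"
    by (rule onorm_le)
  then have "?n s - 1 \<le> (?n t - 1) / t * s"
    by (simp add: algebra_simps diff_divide_distrib)
  then show ?thesis
    using assms(1) by (simp only: pos_divide_le_eq)
qed

text \<open>\<open>Lim\<close> carries information only once convergence is known. A quotient that
  is monotone and bounded below tends to its infimum as h decreases to 0.\<close>

lemma log_norm_tendsto:
  fixes A :: "real^'m^'m"
  shows "((\<lambda>h. (onorm ((*v) (mat 1 + h *\<^sub>R A)) - 1) / h) \<longlongrightarrow> log_norm A) (at_right 0)"
proof -
  define q where "q h = (onorm ((*v) (mat 1 + h *\<^sub>R A)) - 1) / h" for h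
  \<comment> \<open>For a unit vector the preceding quotient bound reads <v, Av> <= q h, a lower
    bound independent of h.\<close>
  obtain v :: "real^'m" where v: "norm v = 1"
    using vector_choose_size[of 1] by auto
  have bdd: "bdd_below (q ` {0<..})"
    using inner_le_log_norm_quotient[of _ v A] v
    by (intro bdd_belowI[of _ "v \<bullet> (A *v v)"]) (auto simp: q_def)
  have "(q \<longlongrightarrow> Inf (q ` {0<..})) (at_right 0)"
  proof (rule order_tendstoI)
    fix a assume "a < Inf (q ` {0<..})"
    then have "a < q h" if "h > 0" for h
      using cInf_lower[OF _ bdd, of "q h"] that by fastforce
    then show "\<forall>\<^sub>F h in at_right 0. a < q h"
      by (auto simp: eventually_at_right_less eventually_at_filter)
  next
    fix a assume "Inf (q ` {0<..}) < a"
    then obtain t where t: "t > 0" "q t < a"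
      using cInf_lessD[of "q ` {0<..}" a] by auto
    \<comment> \<open>A single value below \<open>a\<close> suffices: monotonicity carries it to all
      smaller positive h.\<close>
    have "q h < a" if "0 < h" "h < t" for h
      using log_norm_quotient_mono[of h t A] that t by (simp add: q_def)
    then show "\<forall>\<^sub>F h in at_right 0. q h < a"
      using t(1) unfolding eventually_at_right_field by blast
  qed
  moreover from this have "log_norm A = Inf (q ` {0<..})"
    unfolding log_norm_def q_def[abs_def] by (intro tendsto_Lim) auto
  ultimately show ?thesis
    by (simp only: q_def[abs_def])
qed

text \<open>The quotient bound survives the limit h -> 0+. Through this inequality the logarithmic
  norm enters the growth estimate.\<close>

lemma inner_le_log_norm:
  fixes A :: "real^'m^'m"
  shows "v \<bullet> (A *v v) \<le> log_norm A * (norm v)\<^sup>2"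
proof (rule tendsto_lowerbound)
  show "((\<lambda>h. (onorm ((*v) (mat 1 + h *\<^sub>R A)) - 1) / h * (norm v)\<^sup>2)
      \<longlongrightarrow> log_norm A * (norm v)\<^sup>2) (at_right 0)"
    by (intro tendsto_intros log_norm_tendsto)
  show "\<forall>\<^sub>F h in at_right 0. v \<bullet> (A *v v) \<le> (onorm ((*v) (mat 1 + h *\<^sub>R A)) - 1) / h * (norm v)\<^sup>2"
    using eventually_at_right_less by (rule eventually_mono) (rule inner_le_log_norm_quotient)
qed simp

section \<open>Gronwall estimates for real functions and for norms\<close>

text \<open>The integrating factor exp (- \<nu> s) makes
  \<open>u s * exp (- \<nu> * s) - c * g s\<close> nonincreasing. Keeping the antiderivative
  \<open>g\<close> abstract treats \<nu> = 0 and \<nu> nonzero at once.\<close>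

lemma differential_inequality_linear:
  fixes u u' g :: "real \<Rightarrow> real"
  assumes "0 \<le> t"
    and u: "\<And>s. s \<in> {0..t} \<Longrightarrow> (u has_real_derivative u' s) (at s within {0..t})"
    and u': "\<And>s. s \<in> {0..t} \<Longrightarrow> u' s \<le> \<nu> * u s + c"
    and g: "\<And>s. (g has_real_derivative exp (- \<nu> * s)) (at s)" and "g 0 = 0"
  shows "u t \<le> exp (\<nu> * t) * (u 0 + c * g t)"
proof -
  let ?w = "\<lambda>s. u s * exp (- \<nu> * s) - c * g s"
  let ?w' = "\<lambda>s. (u' s - \<nu> * u s - c) * exp (- \<nu> * s)"
  have w: "(?w has_real_derivative ?w' s) (at s within {0..t})" if "s \<in> {0..t}" for s
    by (rule derivative_eq_intros u[OF that] has_field_derivative_at_within[OF g] refl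
        | simp add: algebra_simps)+
  have "?w t \<le> ?w 0"
  proof (cases "t = 0")
    case False
    with \<open>0 \<le> t\<close> have "0 < t" by simp
    then obtain s where s: "s \<in> {0<..<t}" "?w t - ?w 0 = ?w' s * (t - 0)"
      using mvt_simple[of 0 t ?w "\<lambda>s h. ?w' s * h"] w
      by (auto simp: has_field_derivative_def)
    have "?w' s * t \<le> 0"
      using u'[of s] s(1) by (intro mult_nonpos_nonneg) auto
    with s(2) show ?thesis by simp
  qed simp
  then have "u t * exp (- \<nu> * t) \<le> u 0 + c * g t"
    using \<open>g 0 = 0\<close> by simp
  then show ?thesis
    by (simp add: exp_minus field_simps)
qed

text \<open>The positive summand \<open>d\<^sup>2\<close> keeps the root differentiable where
  \<open>v\<close> vanishes; the price is the extra forcing |\<nu>| d.\<close>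

lemma norm_gronwall_regularized:
  fixes v v' :: "real \<Rightarrow> 'a::real_inner" and g :: "real \<Rightarrow> real"
  assumes "0 \<le> t" "0 < d" "0 \<le> E"
    and v: "\<And>s. s \<in> {0..t} \<Longrightarrow> (v has_vector_derivative v' s) (at s within {0..t})"
    and v': "\<And>s. s \<in> {0..t} \<Longrightarrow> v s \<bullet> v' s \<le> \<nu> * (norm (v s))\<^sup>2 + E * norm (v s)"
    and g: "\<And>s. (g has_real_derivative exp (- \<nu> * s)) (at s)" "g 0 = 0"
  shows "sqrt ((norm (v t))\<^sup>2 + d\<^sup>2)
    \<le> exp (\<nu> * t) * (sqrt ((norm (v 0))\<^sup>2 + d\<^sup>2) + (E + \<bar>\<nu>\<bar> * d) * g t)"
proof -
  define u where "u s = sqrt ((norm (v s))\<^sup>2 + d\<^sup>2)" for s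
  have pos: "(norm (v s))\<^sup>2 + d\<^sup>2 > 0" for s
    using \<open>0 < d\<close> by (simp add: add_nonneg_pos)
  then have u_pos: "u s > 0" and u_sq: "(u s)\<^sup>2 = (norm (v s))\<^sup>2 + d\<^sup>2" for s
    by (auto simp: u_def less_imp_le)
  have d_le: "d \<le> u s" and v_le: "norm (v s) \<le> u s" for s
    unfolding u_def by (auto intro: real_le_rsqrt)
  have u_deriv: "(u has_real_derivative (v s \<bullet> v' s) / u s) (at s within {0..t})"
    if "s \<in> {0..t}" for s
  proof -
    have "((\<lambda>s. v s \<bullet> v s) has_real_derivative 2 * (v s \<bullet> v' s)) (at s within {0..t})"
      using has_derivative_inner[OF v[OF that, unfolded has_vector_derivative_def]
          v[OF that, unfolded has_vector_derivative_def]]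
      unfolding has_field_derivative_def
      by (rule has_derivative_eq_rhs) (auto simp: inner_commute algebra_simps)
    then have "((\<lambda>s. (norm (v s))\<^sup>2 + d\<^sup>2) has_real_derivative 2 * (v s \<bullet> v' s))
        (at s within {0..t})"
      by (auto intro!: derivative_eq_intros simp: power2_norm_eq_inner)
    from DERIV_chain2[OF DERIV_real_sqrt[OF pos] this]
    show ?thesis
      by (simp add: u_def[abs_def] field_simps)
  qed
  have "(v s \<bullet> v' s) / u s \<le> \<nu> * u s + (E + \<bar>\<nu>\<bar> * d)" if "s \<in> {0..t}" for s
  proof -
    have "v s \<bullet> v' s \<le> \<nu> * (norm (v s))\<^sup>2 + E * norm (v s)"
      by (rule v'[OF that])
    \<comment> \<open>Replacing |v|^2 by u^2 - d^2 leaves a remainder whose sign depends on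
      \<nu>.\<close>
    also have "\<dots> = \<nu> * (u s)\<^sup>2 + (- \<nu>) * (d * d) + E * norm (v s)"
      by (simp add: u_sq algebra_simps flip: power2_eq_square)
    \<comment> \<open>Using d <= u for one factor of d^2, and |v| <= u, puts a factor u in every
      term, ready for division by u.\<close>
    also have "\<dots> \<le> \<nu> * (u s)\<^sup>2 + \<bar>\<nu>\<bar> * (d * u s) + E * u s"
      using d_le[of s] v_le[of s] \<open>0 < d\<close> \<open>0 \<le> E\<close>
      by (intro add_mono mult_mono mult_left_mono order_refl) auto
    also have "\<dots> = (\<nu> * u s + (E + \<bar>\<nu>\<bar> * d)) * u s"
      by (simp add: algebra_simps power2_eq_square)
    finally show ?thesis
      using u_pos[of s] by (simp add: pos_divide_le_eq)
  qed
  from differential_inequality_linear[OF \<open>0 \<le> t\<close> u_deriv this g]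
  show ?thesis
    by (simp add: u_def)
qed

lemma norm_gronwall:
  fixes v v' :: "real \<Rightarrow> 'a::real_inner" and g :: "real \<Rightarrow> real"
  assumes "0 \<le> t" "0 \<le> E"
    and v: "\<And>s. s \<in> {0..t} \<Longrightarrow> (v has_vector_derivative v' s) (at s within {0..t})"
    and v': "\<And>s. s \<in> {0..t} \<Longrightarrow> v s \<bullet> v' s \<le> \<nu> * (norm (v s))\<^sup>2 + E * norm (v s)"
    and g: "\<And>s. (g has_real_derivative exp (- \<nu> * s)) (at s)" "g 0 = 0"
  shows "norm (v t) \<le> exp (\<nu> * t) * (norm (v 0) + E * g t)"
proof -
  \<comment> \<open>The zeros are left unevaluated so that both sides are literally the limits of
    the regularized bound as d -> 0+.\<close>
  have "sqrt ((norm (v t))\<^sup>2 + 0\<^sup>2)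
      \<le> exp (\<nu> * t) * (sqrt ((norm (v 0))\<^sup>2 + 0\<^sup>2) + (E + \<bar>\<nu>\<bar> * 0) * g t)"
  proof (rule tendsto_le[OF trivial_limit_at_right_real])
    show "((\<lambda>d. sqrt ((norm (v t))\<^sup>2 + d\<^sup>2)) \<longlongrightarrow> sqrt ((norm (v t))\<^sup>2 + 0\<^sup>2)) (at_right 0)"
      by (intro tendsto_intros)
    show "((\<lambda>d. exp (\<nu> * t) * (sqrt ((norm (v 0))\<^sup>2 + d\<^sup>2) + (E + \<bar>\<nu>\<bar> * d) * g t)) \<longlongrightarrow>
        exp (\<nu> * t) * (sqrt ((norm (v 0))\<^sup>2 + 0\<^sup>2) + (E + \<bar>\<nu>\<bar> * 0) * g t)) (at_right 0)"
      by (intro tendsto_intros)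
    show "\<forall>\<^sub>F d in at_right 0. sqrt ((norm (v t))\<^sup>2 + d\<^sup>2)
        \<le> exp (\<nu> * t) * (sqrt ((norm (v 0))\<^sup>2 + d\<^sup>2) + (E + \<bar>\<nu>\<bar> * d) * g t)"
      using norm_gronwall_regularized[OF assms(1) _ assms(2-6)]
      by (auto simp: eventually_at_filter)
  qed
  then show ?thesis by simp
qed

section \<open>Maxima over K and calculus relative to K\<close>

text \<open>By compactness the supremum is attained, so \<open>GREATEST\<close> denotes a genuine
  maximum instead of an unspecified value.\<close>

lemma le_max_on:
  fixes g :: "'a::topological_space \<Rightarrow> real"
  assumes "compact K" "continuous_on K g" "x \<in> K"
  shows "g x \<le> max_on K g"
proof -
  obtain y where "y \<in> K" "\<forall>z\<in>K. g z \<le> g y"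
    using continuous_attains_sup[OF assms(1) _ assms(2)] assms(3) by blast
  then have "max_on K g = g y"
    unfolding max_on_def by (intro Greatest_equality) auto
  with \<open>\<forall>z\<in>K. g z \<le> g y\<close> assms(3) show ?thesis by simp
qed

lemma C1_on_continuous_on:
  assumes "C1_on K g Dg"
  shows "continuous_on K g"
  using assms has_derivative_continuous
  unfolding C1_on_def continuous_on_eq_continuous_within by blast

text \<open>The derivative of \<open>g\<close> exists only relative to K. Restricting it to the
  image of the path, which stays in K, is enough to compose.\<close>

lemma C1_on_chain_rule:
  assumes "C1_on K g Dg" "x ` S \<subseteq> K" "t \<in> S"
    and "(x has_vector_derivative x') (at t within S)"
  shows "((\<lambda>s. g (x s)) has_real_derivative Dg (x t) \<bullet> x') (at t within S)"
proof -
  have "(g has_derivative (\<lambda>v. Dg (x t) \<bullet> v)) (at (x t) within x ` S)"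
    using assms(1-3) by (auto simp: C1_on_def intro: has_derivative_subset[OF _ assms(2)])
  from has_derivative_in_compose[OF assms(4)[unfolded has_vector_derivative_def] this]
  show ?thesis
    by (simp add: has_real_derivative_iff_has_vector_derivative has_vector_derivative_def)
qed

lemma closure_error_continuous_on:
  assumes "continuous_on K f" "\<And>k. C1_on K (\<phi> k) (D\<phi> k)"
  shows "continuous_on K (closure_error \<phi> D\<phi> f A k)"
proof -
  have "continuous_on K (D\<phi> k)"
    using assms(2) by (simp add: C1_on_def)
  then show ?thesis
    unfolding closure_error_def[abs_def]
    by (intro continuous_intros assms(1) C1_on_continuous_on[OF assms(2)])
qed

section \<open>The differential equation of the true moments\<close>

lemma norm_mean_le:
  fixes a :: "nat \<Rightarrow> real^'m"
  assumes "N \<ge> 1" "\<And>i. i \<in> {1..N} \<Longrightarrow> norm (a i) \<le> E"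
  shows "norm ((1 / real N) *\<^sub>R (\<Sum>i=1..N. a i)) \<le> E"
proof -
  have "norm (\<Sum>i=1..N. a i) \<le> real N * E"
    using sum_norm_le[of "{1..N}" a "\<lambda>_. E"] assms(2) by simp
  with assms(1) show ?thesis
    by (simp add: field_simps)
qed

lemma has_vector_derivative_vec_lambda:
  fixes g :: "'m::finite \<Rightarrow> real \<Rightarrow> real"
  assumes "\<And>k. (g k has_real_derivative g' k) (at t within S)"
  shows "((\<lambda>s. \<chi> k. g k s) has_vector_derivative (\<chi> k. g' k)) (at t within S)"
  unfolding has_vector_derivative_def
proof (subst has_derivative_componentwise_within, rule ballI)
  fix b :: "real^'m" assume "b \<in> Basis"
  then obtain k where "b = axis k 1"
    by (auto simp: Basis_vec_def)
  then show "((\<lambda>s. (\<chi> k. g k s) \<bullet> b) has_derivative (\<lambda>h. (h *\<^sub>R (\<chi> k. g' k)) \<bullet> b)) (at t within S)"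
    using assms[of k]
    by (simp add: inner_axis has_real_derivative_iff_has_vector_derivative has_vector_derivative_def)
qed

text \<open>The closure error is what remains of the derivative of a kernel along the flow after its
  linear part is removed. Averaged over the agents, the linear part becomes \<open>A\<close> applied
  to the moments.\<close>

lemma moments_has_vector_derivative:
  fixes \<phi> :: "'m::finite \<Rightarrow> real^'d \<Rightarrow> real"
  assumes "\<And>k. C1_on K (\<phi> k) (D\<phi> k)" "t \<in> S"
    and "\<And>i s. i \<in> {1..N} \<Longrightarrow> s \<in> S \<Longrightarrow> x i s \<in> K"
    and "\<And>i. i \<in> {1..N} \<Longrightarrow> (x i has_vector_derivative f (x i t)) (at t within S)"
  shows "(moments \<phi> N x has_vector_derivative
      A *v moments \<phi> N x t
        + (1 / real N) *\<^sub>R (\<Sum>i=1..N. \<chi> k. closure_error \<phi> D\<phi> f A k (x i t))) (at t within S)"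
proof -
  have "((\<lambda>s. (1 / real N) * (\<Sum>i=1..N. \<phi> k (x i s))) has_real_derivative
      (1 / real N) * (\<Sum>i=1..N. D\<phi> k (x i t) \<bullet> f (x i t))) (at t within S)" for k
    by (intro DERIV_cmult DERIV_sum C1_on_chain_rule[OF assms(1) _ assms(2) assms(4)])
      (use assms(3) in auto)
  from has_vector_derivative_vec_lambda[OF this]
  have "(moments \<phi> N x has_vector_derivative
      (\<chi> k. (1 / real N) * (\<Sum>i=1..N. D\<phi> k (x i t) \<bullet> f (x i t)))) (at t within S)"
    by (simp add: moments_def[abs_def])
  moreover have "(\<chi> k. (1 / real N) * (\<Sum>i=1..N. D\<phi> k (x i t) \<bullet> f (x i t)))
      = A *v moments \<phi> N x t
        + (1 / real N) *\<^sub>R (\<Sum>i=1..N. \<chi> k. closure_error \<phi> D\<phi> f A k (x i t))"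
  proof -
    have "(\<Sum>l\<in>UNIV. A $ k $ l * ((1 / real N) * (\<Sum>i=1..N. \<phi> l (x i t))))
        = (1 / real N) * (\<Sum>i=1..N. \<Sum>l\<in>UNIV. A $ k $ l * \<phi> l (x i t))" for k
      by (subst sum.swap) (simp add: sum_distrib_left mult.left_commute)
    then show ?thesis
      by (simp add: vec_eq_iff matrix_vector_mult_def moments_def closure_error_def
          sum_subtractf right_diff_distrib del: times_divide_eq_left)
  qed
  ultimately show ?thesis by simp
qed

section \<open>Growth of the difference between true and approximate moments\<close>

theorem theorem3:
  fixes K :: "(real^'d) set"
    and f :: "real^'d \<Rightarrow> real^'d"
    and \<phi> :: "'m::finite \<Rightarrow> real^'d \<Rightarrow> real"
    and D\<phi> :: "'m \<Rightarrow> real^'d \<Rightarrow> real^'d"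
    and A :: "real^'m^'m"
    and N :: nat
    and x :: "nat \<Rightarrow> real \<Rightarrow> real^'d"
    and mbar :: "real \<Rightarrow> real^'m"
    and T :: real
  assumes "compact K"
    and "\<exists>L. L-lipschitz_on K f"
    and "\<And>k. C1_on K (\<phi> k) (D\<phi> k)"
    and "N \<ge> 1"
    and "\<And>i t. i \<in> {1..N} \<Longrightarrow> t \<in> {0..T} \<Longrightarrow>
           (x i has_vector_derivative f (x i t)) (at t within {0..T})"
    and "\<And>i t. i \<in> {1..N} \<Longrightarrow> t \<in> {0..T} \<Longrightarrow> x i t \<in> K"
    and "\<And>t. t \<in> {0..T} \<Longrightarrow> (mbar has_vector_derivative A *v mbar t) (at t within {0..T})"
  defines "\<Delta>m \<equiv> \<lambda>t. moments \<phi> N x t - mbar t"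
    and "E \<equiv> sqrt (\<Sum>k\<in>UNIV. max_on K (\<lambda>y. (closure_error \<phi> D\<phi> f A k y)\<^sup>2))"
    and "\<nu> \<equiv> log_norm A"
  shows "\<forall>t\<in>{0..T}.
           (\<nu> \<noteq> 0 \<longrightarrow> norm (\<Delta>m t) \<le> norm (\<Delta>m 0) * exp (t * \<nu>) + (exp (t * \<nu>) - 1) / \<nu> * E) \<and>
           (\<nu> = 0 \<longrightarrow> norm (\<Delta>m t) \<le> norm (\<Delta>m 0) + t * E)"
proof
  fix t assume t: "t \<in> {0..T}"
  define e where "e s = (1 / real N) *\<^sub>R (\<Sum>i=1..N. \<chi> k. closure_error \<phi> D\<phi> f A k (x i s))" for s
  have "continuous_on K f"
    using assms(2) by (auto intro: lipschitz_on_continuous_on)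
  then have sq_le: "(closure_error \<phi> D\<phi> f A k y)\<^sup>2
      \<le> max_on K (\<lambda>y. (closure_error \<phi> D\<phi> f A k y)\<^sup>2)" if "y \<in> K" for k y
    using that assms(3)
    by (intro le_max_on[OF assms(1)] continuous_on_power closure_error_continuous_on) auto
  \<comment> \<open>Each squared component is bounded by its own maximum over K, which produces the
    root of the sum of maxima.\<close>
  have E: "norm (\<chi> k. closure_error \<phi> D\<phi> f A k y) \<le> E" if "y \<in> K" for y
    unfolding norm_vec_def L2_set_def E_def
    by (intro real_sqrt_le_mono sum_mono) (simp add: sq_le[OF that])
  have e_le: "norm (e s) \<le> E" if "s \<in> {0..T}" for s
    unfolding e_def using assms(4) assms(6) that by (intro norm_mean_le E) auto
  \<comment> \<open>\<open>E\<close> dominates a norm at the given time, so its sign needs no look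
    at the maxima.\<close>
  have "0 \<le> E"
    using e_le[OF t] norm_ge_zero order_trans by blast
  have deriv: "(\<Delta>m has_vector_derivative A *v \<Delta>m s + e s) (at s within {0..t})"
    if "s \<in> {0..t}" for s
  proof -
    have s: "s \<in> {0..T}" using that t by auto
    have "(\<Delta>m has_vector_derivative A *v moments \<phi> N x s + e s - A *v mbar s) (at s within {0..T})"
      unfolding \<Delta>m_def e_def
      by (intro has_vector_derivative_diff moments_has_vector_derivative[OF assms(3) s]
          assms(5-7) s)
    then have "(\<Delta>m has_vector_derivative A *v \<Delta>m s + e s) (at s within {0..T})"
      by (simp add: \<Delta>m_def matrix_vector_mult_diff_distrib algebra_simps)
    \<comment> \<open>The Gronwall lemma is applied on [0,t], so the derivative is restricted from
      [0,T].\<close>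
    then show ?thesis
      by (rule has_vector_derivative_within_subset) (use t in auto)
  qed
  \<comment> \<open>The logarithmic norm controls the linear part, Cauchy-Schwarz the
    forcing.\<close>
  have growth: "\<Delta>m s \<bullet> (A *v \<Delta>m s + e s) \<le> \<nu> * (norm (\<Delta>m s))\<^sup>2 + E * norm (\<Delta>m s)"
    if "s \<in> {0..t}" for s
  proof -
    have "\<Delta>m s \<bullet> e s \<le> norm (\<Delta>m s) * norm (e s)"
      by (rule norm_cauchy_schwarz)
    also have "\<dots> \<le> norm (\<Delta>m s) * E"
      using that t by (intro mult_left_mono e_le) auto
    finally show ?thesis
      using inner_le_log_norm[of "\<Delta>m s" A] by (simp add: inner_add_right \<nu>_def mult.commute)
  qed
  have bound: "norm (\<Delta>m t) \<le> exp (\<nu> * t) * (norm (\<Delta>m 0) + E * g t)"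
    if "\<And>s. (g has_real_derivative exp (- \<nu> * s)) (at s)" "g 0 = 0" for g
    using t by (intro norm_gronwall[OF _ \<open>0 \<le> E\<close> deriv growth that]) auto
  show "(\<nu> \<noteq> 0 \<longrightarrow> norm (\<Delta>m t) \<le> norm (\<Delta>m 0) * exp (t * \<nu>) + (exp (t * \<nu>) - 1) / \<nu> * E) \<and>
      (\<nu> = 0 \<longrightarrow> norm (\<Delta>m t) \<le> norm (\<Delta>m 0) + t * E)"
  proof (intro conjI impI)
    assume "\<nu> \<noteq> 0"
    \<comment> \<open>Here g s = (1 - exp (- \<nu> s)) / \<nu>, the antiderivative of exp (- \<nu>
      s) vanishing at 0.\<close>
    then have "norm (\<Delta>m t) \<le> exp (\<nu> * t) * (norm (\<Delta>m 0) + E * ((1 - exp (- \<nu> * t)) / \<nu>))"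
      by (intro bound) (auto intro!: derivative_eq_intros)
    also have "\<dots> = norm (\<Delta>m 0) * exp (t * \<nu>) + (exp (t * \<nu>) - 1) / \<nu> * E"
      using \<open>\<nu> \<noteq> 0\<close> by (simp add: field_simps exp_minus)
    finally show "norm (\<Delta>m t) \<le> norm (\<Delta>m 0) * exp (t * \<nu>) + (exp (t * \<nu>) - 1) / \<nu> * E" .
  next
    assume "\<nu> = 0"
    \<comment> \<open>For \<nu> = 0 the function to integrate is constantly 1, hence g s =
      s.\<close>
    then show "norm (\<Delta>m t) \<le> norm (\<Delta>m 0) + t * E"
      using bound[of "\<lambda>s. s"] by (simp add: mult.commute)
  qed
qed

end
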